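(* Let $G$ be a finite simple graph. The following are equivalent: (1) $G$ admits an orientation in which every vertex is near-transitive; (2) $G$ admits an acyclic orientation in which every vertex is near-transitive; (3) the induced subgraph $G_B$ of $G$ on its set of benjamins is a comparability graph.
   Context: An orientation of $G$ assigns each edge one direction. In an orientation, a vertex $t$ is transitive if for all vertices $a,b$, $t\to a\to b$ implies $t\to b$; a vertex $v$ is near-transitive if there exists a transitive vertex $t$ with $N[t]\subseteq N[v]$, where $N[u]$ denotes the closed neighbourhood of $u$ in $G$. A vertex $m$ is a benjamin of $G$ if there is no vertex $v$ with $N[v]\subsetneq N[m]$. A comparability graph is a graph admitting a transitive orientation (one in which every vertex is transitive). *)

theory Defs
  imports "Graph_Theory.Digraph_Component"
begin

text \<open>
  As in \<^theory>\<open>Graph_Theory.Digraph\<close>, a finite simple graph is a finite loop-free symmetric digraph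
  without parallel arcs (locale \<^locale>\<open>graph\<close>): an undirected edge is a pair of opposite arcs. An
  orientation is therefore the set of ordered pairs obtained by keeping exactly one of
  \<open>(u, v)\<close>, \<open>(v, u)\<close> for every edge.
\<close>

definition is_orientation :: "('a, 'b) pre_digraph \<Rightarrow> 'a rel \<Rightarrow> bool" where
  "is_orientation G R \<longleftrightarrow>
     R \<subseteq> arcs_ends G \<and>
     (\<forall>(u, v) \<in> arcs_ends G. (u, v) \<in> R \<longleftrightarrow> (v, u) \<notin> R)"

definition closed_nbhd :: "('a, 'b) pre_digraph \<Rightarrow> 'a \<Rightarrow> 'a set" where
  "closed_nbhd G u = insert u {w. (u, w) \<in> arcs_ends G}"

definition transitive_vertex :: "'a rel \<Rightarrow> 'a \<Rightarrow> bool" where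
  "transitive_vertex R t \<longleftrightarrow> (\<forall>a b. (t, a) \<in> R \<longrightarrow> (a, b) \<in> R \<longrightarrow> (t, b) \<in> R)"

definition near_transitive_vertex :: "('a, 'b) pre_digraph \<Rightarrow> 'a rel \<Rightarrow> 'a \<Rightarrow> bool" where
  "near_transitive_vertex G R v \<longleftrightarrow>
     (\<exists>t \<in> verts G. transitive_vertex R t \<and> closed_nbhd G t \<subseteq> closed_nbhd G v)"

definition benjamins :: "('a, 'b) pre_digraph \<Rightarrow> 'a set" where
  "benjamins G = {m \<in> verts G. \<not> (\<exists>v \<in> verts G. closed_nbhd G v \<subset> closed_nbhd G m)}"

definition comparability_graph :: "('a, 'b) pre_digraph \<Rightarrow> bool" where
  "comparability_graph G \<longleftrightarrow>
     (\<exists>R. is_orientation G R \<and> (\<forall>t \<in> verts G. transitive_vertex R t))"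

end

theory Submission
  imports Defs
begin

text \<open>
  Every closed neighbourhood contains one of a benjamin, so it suffices to make the benjamins
  transitive. A transitive orientation of the benjamins stays transitive at them when all edges
  between other vertices and benjamins point towards the benjamins. Conversely, a benjamin can only
  be near-transitive through a twin, so each twin class of benjamins contains a transitive vertex;
  orienting edges between classes like the edges between these representatives, and edges inside a
  class linearly, is transitive.
\<close>

lemma arcs_ends_induce_subgraph:
  "arcs_ends (G \<restriction> B) = arcs_ends G \<inter> B \<times> B"
  by (auto simp: arcs_ends_def induce_subgraph_def arc_to_ends_def)

lemma closed_nbhd_self: "u \<in> closed_nbhd G u"
  by (simp add: closed_nbhd_def)

text \<open>Minimality of \<open>m\<close> excludes a proper inclusion, so a vertex witnessing that
  \<open>m\<close> is near-transitive is a twin of \<open>m\<close>.\<close>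

lemma closed_nbhd_twin_benjamin:
  assumes "m \<in> benjamins G" "t \<in> verts G" "closed_nbhd G t \<subseteq> closed_nbhd G m"
  shows "closed_nbhd G t = closed_nbhd G m"
  using assms unfolding benjamins_def by blast

context graph
begin

lemma arcs_ends_sym: "(u, v) \<in> arcs_ends G \<longleftrightarrow> (v, u) \<in> arcs_ends G"
  using sym_arcs by (auto simp: symmetric_def dest: symD)

lemma closed_nbhd_sym: "v \<in> closed_nbhd G u \<longleftrightarrow> u \<in> closed_nbhd G v"
  using arcs_ends_sym by (auto simp: closed_nbhd_def)

lemma arcs_ends_irrefl: "(u, u) \<notin> arcs_ends G"
  using adj_not_same by auto

text \<open>Twins share their closed neighbourhood, so this form lets adjacency pass from a vertex
  to its twins.\<close>

lemma arcs_ends_iff_closed_nbhd: "(u, v) \<in> arcs_ends G \<longleftrightarrow> u \<noteq> v \<and> v \<in> closed_nbhd G u"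
  using arcs_ends_irrefl by (auto simp: closed_nbhd_def)

lemma finite_closed_nbhd: "u \<in> verts G \<Longrightarrow> finite (closed_nbhd G u)"
  by (rule finite_subset[OF _ finite_verts]) (auto simp: closed_nbhd_def dest: adj_in_verts)

text \<open>Passing to strictly smaller closed neighbourhoods terminates by finiteness, and it can
  stop only at a benjamin.\<close>

lemma ex_benjamin_closed_nbhd_subset:
  assumes "v \<in> verts G"
  shows "\<exists>m \<in> benjamins G. closed_nbhd G m \<subseteq> closed_nbhd G v"
  using assms
proof (induction "card (closed_nbhd G v)" arbitrary: v rule: less_induct)
  case less
  show ?case
  proof (cases "v \<in> benjamins G")
    case False
    then obtain w where w: "w \<in> verts G" "closed_nbhd G w \<subset> closed_nbhd G v"
      using less.prems by (auto simp: benjamins_def)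
    then have "card (closed_nbhd G w) < card (closed_nbhd G v)"
      using less.prems finite_closed_nbhd by (intro psubset_card_mono)
    from less.hyps[OF this w(1)] w(2) show ?thesis by blast
  qed blast
qed

lemma comparability_graph_if_near_transitive:
  assumes R: "is_orientation G R"
    and near: "\<And>v. v \<in> verts G \<Longrightarrow> near_transitive_vertex G R v"
  shows "comparability_graph (G \<restriction> benjamins G)"
proof -
  let ?B = "benjamins G"
  \<comment> \<open>The choice depends on \<open>m\<close> only through its closed neighbourhood, so
    all twins receive the same representative.\<close>
  define \<rho> where "\<rho> m = (SOME t. transitive_vertex R t \<and> closed_nbhd G t = closed_nbhd G m)" for m
  have rho: "transitive_vertex R (\<rho> m)" "closed_nbhd G (\<rho> m) = closed_nbhd G m"
    if m: "m \<in> ?B" for m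
  proof -
    from m have "m \<in> verts G" by (simp add: benjamins_def)
    from near[OF this] have "\<exists>t. transitive_vertex R t \<and> closed_nbhd G t = closed_nbhd G m"
      unfolding near_transitive_vertex_def using closed_nbhd_twin_benjamin[OF m] by blast
    from someI_ex[OF this] show "transitive_vertex R (\<rho> m)" "closed_nbhd G (\<rho> m) = closed_nbhd G m"
      by (simp_all add: \<rho>_def)
  qed
  have rho_cong: "\<rho> u = \<rho> v" if "closed_nbhd G u = closed_nbhd G v" for u v
    using that by (simp add: \<rho>_def)
  \<comment> \<open>Twin classes are cliques; an injective numbering orders each of them
    linearly.\<close>
  obtain g :: "'a \<Rightarrow> nat" where g: "inj_on g (verts G)"
    using finite_imp_inj_to_nat_seg[OF finite_verts] by blast
  define S where "S = {(u, v) \<in> arcs_ends G \<inter> ?B \<times> ?B.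
    if closed_nbhd G u = closed_nbhd G v then g u < g v else (\<rho> u, \<rho> v) \<in> R}"
  have rho_adj: "(\<rho> u, \<rho> v) \<in> arcs_ends G"
    if "(u, v) \<in> arcs_ends G" "u \<in> ?B" "v \<in> ?B" "closed_nbhd G u \<noteq> closed_nbhd G v" for u v
    using that rho(2) by (metis arcs_ends_iff_closed_nbhd closed_nbhd_sym)
  have R_asym: "(v, u) \<in> R \<longleftrightarrow> (u, v) \<notin> R" if "(u, v) \<in> arcs_ends G" for u v
    using R that unfolding is_orientation_def by blast
  have R_sub: "R \<subseteq> arcs_ends G"
    using R by (simp add: is_orientation_def)
  have "is_orientation (G \<restriction> ?B) S"
    unfolding is_orientation_def arcs_ends_induce_subgraph
  proof (intro conjI ballI, goal_cases)
    case 1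
    show ?case by (auto simp: S_def)
  next
    case (2 e)
    obtain u v where e: "e = (u, v)" by fastforce
    with 2 have uv: "(u, v) \<in> arcs_ends G" "(v, u) \<in> arcs_ends G" "u \<in> ?B" "v \<in> ?B"
      using arcs_ends_sym by auto
    have "g u \<noteq> g v"
      using g uv arcs_ends_irrefl by (auto simp: benjamins_def dest: inj_onD)
    then show ?case
      using uv R_asym[OF rho_adj[OF uv(1,3,4)]] by (auto simp: e S_def)
  qed
  moreover have "(a, c) \<in> S" if ab: "(a, b) \<in> S" and bc: "(b, c) \<in> S" for a b c
  proof -
    let ?N = "closed_nbhd G"
    have B: "a \<in> ?B" "b \<in> ?B" "c \<in> ?B" and adj: "(a, b) \<in> arcs_ends G" "(b, c) \<in> arcs_ends G"
      using ab bc by (auto simp: S_def)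
    consider (eq) "?N a = ?N b" "?N b = ?N c" | (left) "?N a = ?N b" "?N b \<noteq> ?N c"
      | (right) "?N a \<noteq> ?N b" "?N b = ?N c" | (neq) "?N a \<noteq> ?N b" "?N b \<noteq> ?N c" by blast
    then show ?thesis
    proof cases
      case eq
      then have "g a < g c" using ab bc by (auto simp: S_def)
      moreover from this have "(a, c) \<in> arcs_ends G"
        using adj eq by (auto simp: arcs_ends_iff_closed_nbhd)
      ultimately show ?thesis using eq B by (simp add: S_def)
    next
      \<comment> \<open>As twins, \<open>a\<close> and \<open>b\<close> see the same
        \<open>c\<close>, which differs from \<open>a\<close> because its closed neighbourhood does;
        the arc is inherited through the common representative.\<close>
      case left
      then have "(a, c) \<in> arcs_ends G"
        using adj by (auto simp: arcs_ends_iff_closed_nbhd)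
      then show ?thesis using left bc B rho_cong[OF left(1)] by (simp add: S_def)
    next
      case right
      then have "(a, c) \<in> arcs_ends G"
        using adj by (metis arcs_ends_iff_closed_nbhd closed_nbhd_sym)
      then show ?thesis using right ab B rho_cong[OF right(2)] by (simp add: S_def)
    next
      case neq
      then have "(\<rho> a, \<rho> b) \<in> R" "(\<rho> b, \<rho> c) \<in> R" using ab bc by (auto simp: S_def)
      then have ac: "(\<rho> a, \<rho> c) \<in> R"
        using rho(1)[OF B(1)] unfolding transitive_vertex_def by blast
      then have adj': "\<rho> a \<noteq> \<rho> c" "\<rho> c \<in> ?N (\<rho> a)"
        using R_sub arcs_ends_iff_closed_nbhd by blast+
      \<comment> \<open>Twins \<open>a\<close> and \<open>c\<close> would have equal
        representatives, but these are joined by an arc.\<close>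
      have N: "?N a \<noteq> ?N c" using adj'(1) rho_cong by blast
      have "c \<in> ?N a" using adj'(2) rho(2) B by (metis closed_nbhd_sym closed_nbhd_self)
      then have "(a, c) \<in> arcs_ends G" using N by (auto simp: arcs_ends_iff_closed_nbhd)
      then show ?thesis using B N ac by (simp add: S_def)
    qed
  qed
  ultimately show ?thesis
    unfolding comparability_graph_def transitive_vertex_def by blast
qed

lemma ex_acyclic_near_transitive_orientation:
  assumes "comparability_graph (G \<restriction> benjamins G)"
  shows "\<exists>R. is_orientation G R \<and> acyclic R \<and> (\<forall>v \<in> verts G. near_transitive_vertex G R v)"
proof -
  let ?B = "benjamins G"
  obtain S where S: "is_orientation (G \<restriction> ?B) S"
    and tv: "\<And>t. t \<in> ?B \<Longrightarrow> transitive_vertex S t"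
    using assms by (auto simp: comparability_graph_def)
  have S_sub: "S \<subseteq> arcs_ends G \<inter> ?B \<times> ?B"
    and S_asym: "\<And>u v. (u, v) \<in> arcs_ends G \<inter> ?B \<times> ?B \<Longrightarrow> (v, u) \<in> S \<longleftrightarrow> (u, v) \<notin> S"
    using S unfolding is_orientation_def arcs_ends_induce_subgraph by blast+
  have S_trans: "(a, c) \<in> S" if "(a, b) \<in> S" "(b, c) \<in> S" for a b c
    using that tv[of a] S_sub unfolding transitive_vertex_def by blast
  obtain g :: "'a \<Rightarrow> nat" where g: "inj_on g (verts G)"
    using finite_imp_inj_to_nat_seg[OF finite_verts] by blast
  \<comment> \<open>\<open>T\<close> also relates non-adjacent vertices: this makes it a strict
    order, so its restriction to the edges is acyclic. The non-benjamins come first, sorted by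
    \<open>g\<close>, and the benjamins follow, ordered by \<open>S\<close>.\<close>
  define T where "T = S \<union> (- ?B) \<times> ?B \<union> {(u, v) \<in> (- ?B) \<times> (- ?B). g u < g v}"
  have "trans T"
    using S_sub S_trans by (intro transI) (auto simp: T_def)
  moreover have "(u, u) \<notin> T" for u
    using S_sub arcs_ends_irrefl by (auto simp: T_def)
  ultimately have "acyclic T"
    by (simp add: acyclic_def trancl_id)
  then have "acyclic (T \<inter> arcs_ends G)"
    by (rule acyclic_subset) blast
  moreover have "is_orientation G (T \<inter> arcs_ends G)"
    unfolding is_orientation_def
  proof (intro conjI ballI, goal_cases)
    case (2 e)
    obtain u v where e: "e = (u, v)" by fastforce
    with 2 have uv: "(u, v) \<in> arcs_ends G" "(v, u) \<in> arcs_ends G"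
      using arcs_ends_sym by auto
    have "g u \<noteq> g v"
      using g uv arcs_ends_irrefl adj_in_verts by (metis inj_onD)
    then show ?case
      using uv S_sub S_asym[of u v] by (auto simp: e T_def)
  qed simp
  \<comment> \<open>No pair of \<open>T\<close> leads out of the benjamins, so a directed path
    starting at \<open>t\<close> stays within the transitive relation \<open>S\<close>.\<close>
  moreover have "transitive_vertex (T \<inter> arcs_ends G) t" if "t \<in> ?B" for t
    using that S_sub S_trans by (auto simp: transitive_vertex_def T_def)
  then have "near_transitive_vertex G (T \<inter> arcs_ends G) v" if "v \<in> verts G" for v
    using ex_benjamin_closed_nbhd_subset[OF that]
    by (auto simp: near_transitive_vertex_def benjamins_def)
  ultimately show ?thesis by blast
qed

end

theorem theorem6p2:
  fixes G :: "('a, 'b) pre_digraph"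
  assumes "graph G"
  shows "((\<exists>R. is_orientation G R \<and> (\<forall>v \<in> verts G. near_transitive_vertex G R v)) \<longleftrightarrow>
          (\<exists>R. is_orientation G R \<and> acyclic R \<and> (\<forall>v \<in> verts G. near_transitive_vertex G R v))) \<and>
         ((\<exists>R. is_orientation G R \<and> acyclic R \<and> (\<forall>v \<in> verts G. near_transitive_vertex G R v)) \<longleftrightarrow>
          comparability_graph (G \<restriction> benjamins G))"
  \<comment> \<open>The two lemmas give (1) to (3) and (3) to (2); forgetting acyclicity closes the
    circle.\<close>
  using graph.comparability_graph_if_near_transitive[OF assms]
    graph.ex_acyclic_near_transitive_orientation[OF assms] by blast

end
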